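(* Let $n$ be a positive integer. (a) Let $G$ be a finite graph with $m$ vertices, and let $k_1<k_2$ be elements of $[m]$ such that $\psi_G(\log k_i)=i_{k_i}(G)$ for both $i\in\{1,2\}$ and $\psi_G$ is linear (affine) on $[\log k_1,\log k_2]$. Let $A_1,A_2\subseteq V(G)$ satisfy $|A_i|=k_i$ and $e_G(A_i,A_i^c)=i_{k_i}(G)\cdot k_i$ for both $i\in\{1,2\}$. Then, for all nonnegative integers $n_1,n_2$ with $n_1+n_2=n$, the set $A:=A_1^{n_1}\times A_2^{n_2}\subseteq V(G)^n$ satisfies $$e_{G^n}(A,A^c)=|A|\cdot n\cdot\psi_G\bigl((\log|A|)/n\bigr).$$ (b) Let $G_1,\dots,G_n$ be finite graphs, let $\mathbf{G}:=G_1\square\cdots\square G_n$, and for each $i\in[n]$ let $\emptyset\neq A_i\subseteq V(G_i)$ satisfy $e_{G_i}(A_i,A_i^c)/|A_i|=i_{|A_i|}(G_i)=\psi_{G_i}(\log|A_i|)$. Suppose that $$\max_{i\in[n]}\partial_-\psi_{G_i}(\log|A_i|)\le\min_{i\in[n]}\partial_+\psi_{G_i}(\log|A_i|).$$ Then the set $A:=A_1\times\cdots\times A_n$ satisfies $$e_{\mathbf{G}}(A,A^c)=|A|\cdot\min\left\{\sum_{i=1}^n\psi_{G_i}(h_i):0\le h_i\le\log|V(G_i)|\text{ for all }i,\text{ and }\sum_{i=1}^nh_i=\log|A|\right\}.$$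
   Context: $\log$ is the natural logarithm and $[m]$ denotes $\{1,\dots,m\}$. For a graph $G$ and $A\subseteq V(G)$, $A^c = V(G)\setminus A$ and $e_G(A,A^c)$ is the number of edges of $G$ with exactly one endpoint in $A$. For an $m$-vertex graph $G$ and $k\in[m]$, $i_k(G) := \min\{e_G(A,A^c)/|A| : A\subseteq V(G),\ |A|=k\}$. The function $\psi_G\colon[0,\log m]\to[0,\infty)$ is the convex minorant of the points $(\log k, i_k(G))$, i.e. the largest convex function on $[0,\log m]$ satisfying $\psi_G(\log k)\le i_k(G)$ for all $k\in[m]$. The product graph $G_1\square\cdots\square G_n$ has vertex set $V(G_1)\times\cdots\times V(G_n)$, and its edges are all pairs $\{u,v\}$ for which there is an index $j\in[n]$ such that $u_jv_j\in E(G_j)$ and $u_l=v_l$ for all $l\neq j$; $G^n$ denotes the product of $n$ copies of $G$. $\partial_-\psi(x)$ and $\partial_+\psi(x)$ denote the left and right derivatives of $\psi$ at $x$, with the conventions $\partial_-\psi_{G_i}(0)=-\infty$ and $\partial_+\psi_{G_i}(\log|V(G_i)|)=\infty$. *)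

theory Defs
  imports "HOL-Analysis.Analysis"
begin

datatype 'a graph = Graph (verts: "'a set") (edges: "'a set set")

definition finite_graph :: "'a graph \<Rightarrow> bool" where
  "finite_graph G \<longleftrightarrow> finite (verts G) \<and>
     (\<forall>e\<in>edges G. \<exists>u\<in>verts G. \<exists>v\<in>verts G. u \<noteq> v \<and> e = {u, v})"

definition edge_boundary :: "'a graph \<Rightarrow> 'a set \<Rightarrow> nat" where
  "edge_boundary G A = card {e \<in> edges G. \<exists>u\<in>A. \<exists>v\<in>verts G - A. e = {u, v}}"

definition iso_const :: "'a graph \<Rightarrow> nat \<Rightarrow> real" where
  "iso_const G k =
     Min ((\<lambda>A. real (edge_boundary G A) / real (card A)) ` {A. A \<subseteq> verts G \<and> card A = k})"

definition psi_minorant :: "'a graph \<Rightarrow> (real \<Rightarrow> real) \<Rightarrow> bool" where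
  "psi_minorant G f \<longleftrightarrow> convex_on {0..ln (real (card (verts G)))} f \<and>
     (\<forall>k\<in>{1..card (verts G)}. f (ln (real k)) \<le> iso_const G k)"

text \<open>The largest convex minorant is taken as the pointwise supremum of all convex minorants;
  the value is meaningful on \<open>{0..ln (real (card (verts G)))}\<close> only, where
  \<open>psi_minorant_psi\<close>, \<open>psi_greatest\<close> and \<open>psi_nonneg\<close> below give the characteristic properties.\<close>

definition psi :: "'a graph \<Rightarrow> real \<Rightarrow> real" where
  "psi G x = (SUP f \<in> {f. psi_minorant G f}. f x)"

definition left_derivative :: "(real \<Rightarrow> real) \<Rightarrow> real \<Rightarrow> real" where
  "left_derivative f x = (THE D. (f has_real_derivative D) (at_left x))"

definition right_derivative :: "(real \<Rightarrow> real) \<Rightarrow> real \<Rightarrow> real" where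
  "right_derivative f x = (THE D. (f has_real_derivative D) (at_right x))"

definition left_slope :: "'a graph \<Rightarrow> real \<Rightarrow> ereal" where
  "left_slope G x = (if x = 0 then -\<infinity> else ereal (left_derivative (psi G) x))"

definition right_slope :: "'a graph \<Rightarrow> real \<Rightarrow> ereal" where
  "right_slope G x =
     (if x = ln (real (card (verts G))) then \<infinity> else ereal (right_derivative (psi G) x))"

text \<open>The factors are indexed by \<open>{1..n}\<close>; tuples are extensional functions on this index set.\<close>

definition box_prod :: "nat \<Rightarrow> (nat \<Rightarrow> 'a graph) \<Rightarrow> (nat \<Rightarrow> 'a) graph" where
  "box_prod n G = Graph (\<Pi>\<^sub>E i\<in>{1..n}. verts (G i))
     {{u, v} | u v. u \<in> (\<Pi>\<^sub>E i\<in>{1..n}. verts (G i)) \<and> v \<in> (\<Pi>\<^sub>E i\<in>{1..n}. verts (G i)) \<and>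
        (\<exists>j\<in>{1..n}. {u j, v j} \<in> edges (G j) \<and> (\<forall>l\<in>{1..n}. l \<noteq> j \<longrightarrow> u l = v l))}"

definition graph_power :: "'a graph \<Rightarrow> nat \<Rightarrow> (nat \<Rightarrow> 'a) graph" where
  "graph_power G n = box_prod n (\<lambda>_. G)"

definition is_minimum :: "real set \<Rightarrow> real \<Rightarrow> bool" where
  "is_minimum S t \<longleftrightarrow> t \<in> S \<and> (\<forall>s\<in>S. t \<le> s)"

lemma finite_graph_box_prod:
  assumes "\<And>i. i \<in> {1..n} \<Longrightarrow> finite_graph (G i)"
  shows "finite_graph (box_prod n G)"
proof -
  have neq: "u \<noteq> v" if j: "j \<in> {1..n}" "{u j, v j} \<in> edges (G j)" for u v :: "nat \<Rightarrow> 'a" and j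
  proof
    assume "u = v"
    then have "{v j} \<in> edges (G j)" using j by simp
    then obtain a b where "a \<noteq> b" "{v j} = {a, b}"
      using assms[OF j(1)] unfolding finite_graph_def by blast
    then show False by (metis insertCI singletonD)
  qed
  show ?thesis
    unfolding finite_graph_def box_prod_def graph.sel
  proof (intro conjI ballI)
    show "finite (\<Pi>\<^sub>E i\<in>{1..n}. verts (G i))"
      using assms by (intro finite_PiE) (auto simp: finite_graph_def)
  qed (use neq in blast)
qed

lemma psi_minorant_zero:
  assumes "finite_graph G"
  shows "psi_minorant G (\<lambda>_. 0)"
proof -
  have "0 \<le> iso_const G k" if k: "k \<in> {1..card (verts G)}" for k
  proof -
    have "{A. A \<subseteq> verts G \<and> card A = k} \<noteq> {}"
      using k obtain_subset_with_card_n[of k "verts G"] by auto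
    moreover have "finite {A. A \<subseteq> verts G \<and> card A = k}"
      using assms by (auto simp: finite_graph_def intro: finite_subset[of _ "Pow (verts G)"])
    ultimately show ?thesis
      unfolding iso_const_def by (subst Min_ge_iff) auto
  qed
  then show ?thesis by (auto simp: psi_minorant_def convex_on_def)
qed

lemma psi_minorant_bdd:
  assumes "x \<in> {0..ln (real (card (verts G)))}" "verts G \<noteq> {}" "finite_graph G"
  shows "bdd_above ((\<lambda>f. f x) ` {f. psi_minorant G f})"
proof -
  let ?m = "card (verts G)"
  have m: "?m \<ge> 1" using assms by (simp add: finite_graph_def Suc_le_eq card_gt_0_iff)
  have "f x \<le> max (iso_const G 1) (iso_const G ?m)" if f: "psi_minorant G f" for f
  proof -
    have "f x \<le> max (f 0) (f (ln (real ?m)))"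
      using f assms(1) by (intro convex_on_le_max) (auto simp: psi_minorant_def)
    moreover have "f (ln (real 1)) \<le> iso_const G 1" "f (ln (real ?m)) \<le> iso_const G ?m"
      using f m unfolding psi_minorant_def by (meson atLeastAtMost_iff order_refl)+
    ultimately show ?thesis by simp
  qed
  then show ?thesis by (auto simp: bdd_above_def)
qed

lemma psi_greatest:
  assumes "finite_graph G" "verts G \<noteq> {}" "psi_minorant G f"
    and "x \<in> {0..ln (real (card (verts G)))}"
  shows "f x \<le> psi G x"
  unfolding psi_def using assms by (intro cSUP_upper psi_minorant_bdd) auto

lemma psi_nonneg:
  assumes "finite_graph G" "verts G \<noteq> {}" "x \<in> {0..ln (real (card (verts G)))}"
  shows "0 \<le> psi G x"
  using psi_greatest[OF assms(1,2) psi_minorant_zero[OF assms(1)] assms(3)] .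

lemma psi_minorant_psi:
  assumes "finite_graph G" "verts G \<noteq> {}"
  shows "psi_minorant G (psi G)"
proof -
  let ?I = "{0..ln (real (card (verts G)))}"
  have ne: "{f. psi_minorant G f} \<noteq> {}" using psi_minorant_zero[OF assms(1)] by blast
  have "psi G ((1 - t) *\<^sub>R x + t *\<^sub>R y) \<le> (1 - t) * psi G x + t * psi G y"
    if t: "0 < t" "t < 1" and xy: "x \<in> ?I" "y \<in> ?I" for t x y
    unfolding psi_def[of G "(1 - t) *\<^sub>R x + t *\<^sub>R y"]
  proof (rule cSUP_least[OF ne])
    fix f assume "f \<in> {f. psi_minorant G f}"
    then have f: "psi_minorant G f" by simp
    then have "f ((1 - t) *\<^sub>R x + t *\<^sub>R y) \<le> (1 - t) * f x + t * f y"
      using t xy unfolding psi_minorant_def by (intro convex_onD) auto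
    also have "\<dots> \<le> (1 - t) * psi G x + t * psi G y"
      using t psi_greatest[OF assms f] xy by (intro add_mono mult_left_mono) auto
    finally show "f ((1 - t) *\<^sub>R x + t *\<^sub>R y) \<le> (1 - t) * psi G x + t * psi G y" .
  qed
  then have "convex_on ?I (psi G)" by (intro convex_onI) auto
  moreover have "psi G (ln (real k)) \<le> iso_const G k" if "k \<in> {1..card (verts G)}" for k
    unfolding psi_def using that by (intro cSUP_least[OF ne]) (auto simp: psi_minorant_def)
  ultimately show ?thesis by (simp add: psi_minorant_def)
qed

end

(* The ratio of boundary edges to size is additive over products: an edge leaving A_1 x ... x A_n moves in
   exactly one coordinate j, where it leaves A_j, while the other coordinates range freely over
   the A_i. For (a) this gives n1 psi(log k1) + n2 psi(log k2), which affinity on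
   [log k1, log k2] collapses to a single value of psi. For (b), the slope condition provides a
   common slope c such that every psi_{G_i} lies above the line of slope c touching it at
   log |A_i|; summing these lines over h with prescribed coordinate sum shows that
   h_i = log |A_i| is a minimizer. *)

theory Submission imports Defs begin

section \<open>Edge boundaries and log sizes of product sets\<close>

text \<open>Ordered pairs, with the endpoint in \<open>A\<close> first, replace unordered edges, so
  that a boundary in a product can be taken apart coordinate by coordinate.\<close>

definition boundary_pairs :: "'a graph \<Rightarrow> 'a set \<Rightarrow> ('a \<times> 'a) set" where
  "boundary_pairs G A = {(u, v). u \<in> A \<and> v \<in> verts G - A \<and> {u, v} \<in> edges G}"

text \<open>A boundary edge has one endpoint in \<open>A\<close> and the other outside, so it can be
  oriented out of \<open>A\<close> in just one way.\<close>

lemma edge_boundary_eq_card_pairs: "edge_boundary G A = card (boundary_pairs G A)"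
proof -
  have "bij_betw (\<lambda>(u, v). {u, v}) (boundary_pairs G A)
      {e \<in> edges G. \<exists>u\<in>A. \<exists>v\<in>verts G - A. e = {u, v}}"
    unfolding boundary_pairs_def bij_betw_def
    by (auto simp: inj_on_def doubleton_eq_iff image_iff) 
  then show ?thesis
    unfolding edge_boundary_def by (simp add: bij_betw_same_card)
qed

text \<open>The edge set of \<open>box_prod\<close> lists edges by ordered representatives, and
  \<open>{u, v}\<close> may come from either order; adjacency is symmetric, so one order
  suffices.\<close>

lemma doubleton_in_edges_box_prod:
  "{u, v} \<in> edges (box_prod n G) \<longleftrightarrow>
    u \<in> (\<Pi>\<^sub>E i\<in>{1..n}. verts (G i)) \<and> v \<in> (\<Pi>\<^sub>E i\<in>{1..n}. verts (G i)) \<and>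
    (\<exists>j\<in>{1..n}. {u j, v j} \<in> edges (G j) \<and> (\<forall>l\<in>{1..n}. l \<noteq> j \<longrightarrow> u l = v l))"
  (is "?lhs \<longleftrightarrow> ?R u v")
proof -
  have sym: "?R u v" if "?R v u"
  proof -
    from that obtain j where j: "j \<in> {1..n}" "{v j, u j} \<in> edges (G j)"
      and eq: "\<forall>l\<in>{1..n}. l \<noteq> j \<longrightarrow> v l = u l" by blast
    have "{u j, v j} \<in> edges (G j)" using j by (simp add: insert_commute)
    then show ?thesis using that j(1) eq by (intro conjI bexI[of _ j]) simp_all
  qed
  have "?lhs \<longleftrightarrow> (\<exists>u' v'. {u, v} = {u', v'} \<and> ?R u' v')"
    unfolding box_prod_def graph.sel mem_Collect_eq by (rule refl)
  also have "\<dots> \<longleftrightarrow> ?R u v \<or> ?R v u"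
    unfolding doubleton_eq_iff by blast
  finally show ?thesis using sym by blast
qed

text \<open>A pair leaving the product changes a single coordinate \<open>j\<close> and must leave
  \<open>A j\<close> there. It is encoded by the factor pair \<open>(a, b)\<close> and the common
  remaining coordinates \<open>w\<close>.\<close>

lemma boundary_pairs_box_prod:
  assumes "\<And>i. i \<in> {1..n} \<Longrightarrow> A i \<subseteq> verts (G i)"
  shows "boundary_pairs (box_prod n G) (\<Pi>\<^sub>E i\<in>{1..n}. A i) =
    (\<Union>j\<in>{1..n}. (\<lambda>((a, b), w). (w(j := a), w(j := b))) `
       (boundary_pairs (G j) (A j) \<times> (\<Pi>\<^sub>E i\<in>{1..n} - {j}. A i)))"
  (is "?L = (\<Union>j\<in>_. ?f j ` (?B j \<times> ?W j))")
proof (intro set_eqI iffI)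
  fix p assume p: "p \<in> ?L"
  obtain u v where [simp]: "p = (u, v)" by fastforce
  have u: "u \<in> (\<Pi>\<^sub>E i\<in>{1..n}. A i)" and v: "v \<in> (\<Pi>\<^sub>E i\<in>{1..n}. verts (G i))"
    and vn: "v \<notin> (\<Pi>\<^sub>E i\<in>{1..n}. A i)" and e: "{u, v} \<in> edges (box_prod n G)"
    using p by (auto simp: boundary_pairs_def box_prod_def)
  from e obtain j where j: "j \<in> {1..n}" "{u j, v j} \<in> edges (G j)"
    and eq: "\<And>l. l \<in> {1..n} \<Longrightarrow> l \<noteq> j \<Longrightarrow> u l = v l"
    unfolding doubleton_in_edges_box_prod by blast
  \<comment> \<open>\<open>v\<close> misses the product at some coordinate; away from
    \<open>j\<close> it agrees with \<open>u\<close>, which stays inside, so that coordinate is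
    \<open>j\<close>.\<close>
  obtain l where l: "l \<in> {1..n}" "v l \<notin> A l"
    using v vn by (auto simp: PiE_iff)
  then have "l = j" using eq u by (metis PiE_mem)
  then have B: "(u j, v j) \<in> ?B j"
    using j l u v by (auto simp: boundary_pairs_def PiE_iff)
  \<comment> \<open>Restricting makes \<open>w\<close> undefined at \<open>j\<close>, as membership
    in the extensional product over the other indices demands.\<close>
  define w where "w = restrict u ({1..n} - {j})"
  have w: "w \<in> ?W j" using u unfolding w_def by (auto simp: PiE_iff)
  have ui: "u = w(j := u j)" 
    using u unfolding w_def by (auto simp: fun_eq_iff PiE_iff extensional_def)
  have vi: "v = w(j := v j)" 
    using v eq unfolding w_def by (auto simp: fun_eq_iff PiE_iff extensional_def)
  have "p = ?f j ((u j, v j), w)" using ui vi by simp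
  then show "p \<in> (\<Union>j\<in>{1..n}. ?f j ` (?B j \<times> ?W j))"
    using j B w by blast
next
  fix p assume "p \<in> (\<Union>j\<in>{1..n}. ?f j ` (?B j \<times> ?W j))"
  then obtain j a b w where j: "j \<in> {1..n}" and ab: "(a, b) \<in> ?B j" and w: "w \<in> ?W j"
    and [simp]: "p = (w(j := a), w(j := b))"
    by auto
  have ab': "a \<in> A j" "b \<in> verts (G j)" "b \<notin> A j" "{a, b} \<in> edges (G j)"
    using ab by (auto simp: boundary_pairs_def)
  have 1: "w(j := a) \<in> (\<Pi>\<^sub>E i\<in>{1..n}. A i)"
    using w ab' j by (auto simp: PiE_iff extensional_def)
  have "(\<Pi>\<^sub>E i\<in>{1..n}. A i) \<subseteq> (\<Pi>\<^sub>E i\<in>{1..n}. verts (G i))"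
    using assms by (intro PiE_mono) auto
  with 1 have 2: "w(j := a) \<in> (\<Pi>\<^sub>E i\<in>{1..n}. verts (G i))" by blast
  have 3: "w(j := b) \<in> (\<Pi>\<^sub>E i\<in>{1..n}. verts (G i))"
    using 2 ab' j by (auto simp: PiE_iff extensional_def)
  have 4: "w(j := b) \<notin> (\<Pi>\<^sub>E i\<in>{1..n}. A i)"
    using ab' j by (auto simp: PiE_iff)
  have "{w(j := a), w(j := b)} \<in> edges (box_prod n G)"
    unfolding doubleton_in_edges_box_prod using 2 3 ab' j by auto
  then show "p \<in> ?L" using 1 3 4 by (simp add: boundary_pairs_def box_prod_def)
qed

text \<open>The pieces for different \<open>j\<close> are disjoint, and piece \<open>j\<close> has
  as many pairs as the boundary of \<open>A j\<close> times the product of the other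
  \<open>A i\<close>; the latter size is that of the whole product divided by
  \<open>card (A j)\<close>.\<close>

lemma edge_boundary_box_prod:
  assumes fin: "\<And>i. i \<in> {1..n} \<Longrightarrow> finite_graph (G i)"
    and sub: "\<And>i. i \<in> {1..n} \<Longrightarrow> A i \<subseteq> verts (G i)"
    and ne: "\<And>i. i \<in> {1..n} \<Longrightarrow> A i \<noteq> {}"
  shows "real (edge_boundary (box_prod n G) (\<Pi>\<^sub>E i\<in>{1..n}. A i)) =
    real (card (\<Pi>\<^sub>E i\<in>{1..n}. A i)) *
      (\<Sum>i=1..n. real (edge_boundary (G i) (A i)) / real (card (A i)))"
proof -
  let ?B = "\<lambda>j. boundary_pairs (G j) (A j)"
  let ?W = "\<lambda>j. \<Pi>\<^sub>E i\<in>{1..n} - {j}. A i"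
  let ?f = "\<lambda>j. \<lambda>((a, b), w). (w(j := a), w(j := b))"
  have finA: "finite (A i)" if "i \<in> {1..n}" for i
    using fin[OF that] sub[OF that] by (auto simp: finite_graph_def intro: finite_subset)
  have finB: "finite (?B i)" if "i \<in> {1..n}" for i
  proof (rule finite_subset)
    show "?B i \<subseteq> A i \<times> verts (G i)" by (auto simp: boundary_pairs_def)
    show "finite (A i \<times> verts (G i))" using finA fin that by (auto simp: finite_graph_def)
  qed
  have finW: "finite (?W j)" for j using finA by (intro finite_PiE) auto
  have Bne: "a \<noteq> b" if "(a, b) \<in> ?B i" for a b i
    using that by (auto simp: boundary_pairs_def)
  have inj: "inj_on (?f j) (?B j \<times> ?W j)" for j
  proof (rule inj_on_inverseI)
    fix p assume "p \<in> ?B j \<times> ?W j"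
    then obtain a b w where p: "p = ((a, b), w)" and w: "w \<in> ?W j" by auto
    \<comment> \<open>Members of the reduced product are undefined at \<open>j\<close>, so resetting
      that coordinate recovers \<open>w\<close>; this gives a left inverse.\<close>
    have "w j = undefined" using w by (rule PiE_arb) simp
    then have "w(j := undefined) = w" by (rule fun_upd_idem)
    then show "(\<lambda>(u, v). ((u j, v j), u(j := undefined))) (?f j p) = p" by (simp add: p)
  qed
  have disj: "?f i ` (?B i \<times> ?W i) \<inter> ?f j ` (?B j \<times> ?W j) = {}" if "i \<noteq> j" for i j
  proof -
    \<comment> \<open>The set of coordinates in which the two members of a pair differ recovers the
      index of its piece.\<close>
    have diff: "{l. fst p l \<noteq> snd p l} = {k}" if p: "p \<in> ?f k ` (?B k \<times> ?W k)" for p k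
    proof -
      obtain a b w where "(a, b) \<in> ?B k" "p = (w(k := a), w(k := b))" using p by auto
      then show ?thesis using Bne[of a b k] by auto
    qed
    show ?thesis
    proof (rule equals0I)
      fix p assume "p \<in> ?f i ` (?B i \<times> ?W i) \<inter> ?f j ` (?B j \<times> ?W j)"
      then have "{i} = {j}" using diff[of p i] diff[of p j] by blast
      with that show False by simp
    qed
  qed
  have card_P: "card (\<Pi>\<^sub>E i\<in>{1..n}. A i) = card (A j) * card (?W j)" if "j \<in> {1..n}" for j
    using that by (simp add: card_PiE prod.remove)
  have "edge_boundary (box_prod n G) (\<Pi>\<^sub>E i\<in>{1..n}. A i) =
      card (\<Union>j\<in>{1..n}. ?f j ` (?B j \<times> ?W j))"
    unfolding edge_boundary_eq_card_pairs by (subst boundary_pairs_box_prod) (use sub in auto)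
  also have "\<dots> = (\<Sum>j=1..n. card (?f j ` (?B j \<times> ?W j)))"
    by (intro card_UN_disjoint ballI impI disj finite_imageI finite_cartesian_product finB finW) simp_all
  also have "\<dots> = (\<Sum>j=1..n. card (?B j) * card (?W j))"
    by (intro sum.cong refl) (subst card_image[OF inj], simp add: card_cartesian_product)
  finally have "real (edge_boundary (box_prod n G) (\<Pi>\<^sub>E i\<in>{1..n}. A i)) =
      (\<Sum>j=1..n. real (card (?B j)) * real (card (?W j)))" by simp
  also have "\<dots> = (\<Sum>j=1..n. real (card (\<Pi>\<^sub>E i\<in>{1..n}. A i)) *
      (real (edge_boundary (G j) (A j)) / real (card (A j))))"
  proof (rule sum.cong[OF refl])
    fix j assume j: "j \<in> {1..n}"
    have "card (A j) \<noteq> 0" using finA[OF j] ne[OF j] by simp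
    then show "real (card (?B j)) * real (card (?W j)) = real (card (\<Pi>\<^sub>E i\<in>{1..n}. A i)) *
      (real (edge_boundary (G j) (A j)) / real (card (A j)))"
      unfolding card_P[OF j] edge_boundary_eq_card_pairs by simp
  qed
  finally show ?thesis by (simp only: sum_distrib_left)
qed

lemma ln_card_PiE:
  assumes "finite I" "\<And>i. i \<in> I \<Longrightarrow> finite (A i)" "\<And>i. i \<in> I \<Longrightarrow> A i \<noteq> {}"
  shows "ln (real (card (\<Pi>\<^sub>E i\<in>I. A i))) = (\<Sum>i\<in>I. ln (real (card (A i))))"
  using assms by (simp add: card_PiE ln_prod card_gt_0_iff)

text \<open>Uniqueness of limits makes the \<open>THE\<close> in the definition well determined,
  since \<open>at_right x\<close> is a nontrivial filter on the reals.\<close>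

lemma right_derivative_eqI:
  "(f has_real_derivative D) (at_right x) \<Longrightarrow> right_derivative f x = D"
  unfolding right_derivative_def has_field_derivative_iff
  by (rule the_equality, assumption) (metis tendsto_unique trivial_limit_at_right_real)

lemma left_derivative_eqI:
  "(f has_real_derivative D) (at_left x) \<Longrightarrow> left_derivative f x = D"
  unfolding left_derivative_def has_field_derivative_iff
  by (rule the_equality, assumption) (metis tendsto_unique trivial_limit_at_left_real)

section \<open>One-sided derivatives of convex functions\<close>

text \<open>By convexity the difference quotients at \<open>x\<close> decrease as \<open>y\<close>
  falls to \<open>x\<close>, so they converge to their infimum. The bound \<open>C\<close> keeps
  that infimum finite even when \<open>x\<close> is an endpoint of the domain, where convexity alone
  allows a jump or a vertical tangent.\<close>

lemma convex_has_right_derivative: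
  fixes f :: "real \<Rightarrow> real"
  assumes cvx: "convex_on {x..b} f" and "x < b"
    and low: "\<And>y. y \<in> {x<..b} \<Longrightarrow> C \<le> (f y - f x) / (y - x)"
  obtains D where "(f has_real_derivative D) (at_right x)"
    and "\<And>y. y \<in> {x<..b} \<Longrightarrow> D \<le> (f y - f x) / (y - x)"
proof -
  define s where "s = (\<lambda>y. (f y - f x) / (y - x))"
  define D where "D = (INF y\<in>{x<..b}. s y)"
  have bdd: "bdd_below (s ` {x<..b})"
    unfolding s_def using low by (rule bdd_belowI2)
  have D: "D \<le> s y" if "y \<in> {x<..b}" for y
    unfolding D_def using bdd that by (rule cINF_lower)
  have mono: "s y \<le> s z" if "x < y" "y < z" "z \<le> b" for y z
  proof -
    have "(f x - f y) / (x - y) \<le> (f x - f z) / (x - z)"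
      using that by (intro convex_on_slope_le[OF cvx]) auto
    moreover have "s u = (f x - f u) / (x - u)" for u
      unfolding s_def by (metis minus_diff_eq minus_divide_divide)
    ultimately show ?thesis by simp
  qed
  have "(s \<longlongrightarrow> D) (at_right x)"
  proof (rule order_tendstoI)
    fix a assume "a < D"
    have "eventually (\<lambda>y. y \<in> {x<..<b}) (at_right x)"
      using \<open>x < b\<close> by (rule eventually_at_right_real)
    then show "eventually (\<lambda>y. a < s y) (at_right x)"
      by eventually_elim (use D \<open>a < D\<close> in force)
  next
    fix a assume "D < a"
    \<comment> \<open>One quotient below \<open>a\<close>, found at \<open>z\<close>, suffices:
      monotonicity keeps all quotients nearer to \<open>x\<close> below \<open>a\<close>
      too.\<close>
    then obtain z where z: "z \<in> {x<..b}" "s z < a"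
      unfolding D_def using bdd \<open>x < b\<close> by (subst (asm) cINF_less_iff) auto
    have "eventually (\<lambda>y. y \<in> {x<..<z}) (at_right x)"
      using z by (intro eventually_at_right_real) auto
    then show "eventually (\<lambda>y. s y < a) (at_right x)"
      by eventually_elim (use mono[of _ z] z in force)
  qed
  then show thesis
    using D by (intro that[of D]) (auto simp: has_field_derivative_iff s_def)
qed

lemma convex_right_derivative_le_slope:
  fixes f :: "real \<Rightarrow> real"
  assumes "convex_on {x..b} f" and y: "y \<in> {x<..b}"
    and "\<And>y. y \<in> {x<..b} \<Longrightarrow> C \<le> (f y - f x) / (y - x)"
  shows "right_derivative f x \<le> (f y - f x) / (y - x)"
proof -
  obtain D where "(f has_real_derivative D) (at_right x)"
    and "\<And>y. y \<in> {x<..b} \<Longrightarrow> D \<le> (f y - f x) / (y - x)"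
    using convex_has_right_derivative[of x b f C] assms by auto
  then show ?thesis using y by (simp add: right_derivative_eqI)
qed

text \<open>Reflecting the axis turns left quotients at \<open>x\<close> into negated right
  quotients at \<open>- x\<close>, so the upper bound \<open>C\<close> becomes the lower bound
  \<open>- C\<close> and the right-hand case applies.\<close>

lemma convex_slope_le_left_derivative:
  fixes f :: "real \<Rightarrow> real"
  assumes cvx: "convex_on {a..x} f" and y: "y \<in> {a..<x}"
    and up: "\<And>y. y \<in> {a..<x} \<Longrightarrow> (f x - f y) / (x - y) \<le> C"
  shows "(f x - f y) / (x - y) \<le> left_derivative f x"
proof -
  let ?g = "\<lambda>y. f (- y)"
  have flip: "(?g u - ?g (- x)) / (u - - x) = - ((f x - f (- u)) / (x - - u))" for u
    by (simp add: minus_divide_left add.commute)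
  have "convex_on {- x..- a} ?g"
  proof (rule convex_onI)
    fix t u v :: real
    assume "0 < t" "t < 1" "u \<in> {- x..- a}" "v \<in> {- x..- a}"
    then have "f ((1 - t) *\<^sub>R (- u) + t *\<^sub>R (- v)) \<le> (1 - t) * f (- u) + t * f (- v)"
      by (intro convex_onD[OF cvx]) auto
    then show "?g ((1 - t) *\<^sub>R u + t *\<^sub>R v) \<le> (1 - t) * ?g u + t * ?g v" by simp
  qed (rule convex_real_interval)
  moreover have "- C \<le> (?g u - ?g (- x)) / (u - - x)" if "u \<in> {- x<..- a}" for u
    unfolding flip using up[of "- u"] that by auto
  ultimately obtain D where D: "(?g has_real_derivative D) (at_right (- x))"
    and le: "\<And>u. u \<in> {- x<..- a} \<Longrightarrow> D \<le> (?g u - ?g (- x)) / (u - - x)"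
    using y convex_has_right_derivative[of "- x" "- a" ?g "- C"] by auto
  have "((\<lambda>u. - ((?g u - ?g (- x)) / (u - - x))) \<longlongrightarrow> - D) (at_right (- x))"
    using D unfolding has_field_derivative_iff by (rule tendsto_minus)
  moreover have "- ((?g u - ?g (- x)) / (u - - x)) = (f (- u) - f x) / (- u - x)" for u
    unfolding flip by (metis minus_diff_eq minus_divide_divide minus_minus)
  ultimately have "(f has_real_derivative - D) (at_left x)"
    unfolding has_field_derivative_iff filterlim_at_left_to_right by simp
  then have "left_derivative f x = - D" by (rule left_derivative_eqI)
  with le[of "- y"] y show ?thesis unfolding flip by simp
qed

section \<open>Difference quotients and supporting lines of \<open>psi\<close>\<close>

text \<open>Excludes a vertical right tangent of \<^term>\<open>psi G\<close> at 0, so that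
  \<^const>\<open>right_derivative\<close> is not a junk value there.\<close>

lemma affine_le_psi:
  assumes G: "finite_graph G" and k: "1 \<le> card (verts G)"
    and x: "x \<in> {0..ln (real (card (verts G)))}"
  shows "iso_const G 1 - iso_const G 1 / ln 2 * x \<le> psi G x"
proof (rule psi_greatest[OF G _ _ x])
  show "verts G \<noteq> {}" using k by auto
  have nonneg: "0 \<le> iso_const G k" if "k \<in> {1..card (verts G)}" for k
    using psi_minorant_zero[OF G] that by (simp add: psi_minorant_def)
  \<comment> \<open>The line through the points \<open>(0, iso_const G 1)\<close> and
    \<open>(ln 2, 0)\<close>: it meets the bound at \<open>k = 1\<close> and is at most 0 at
    \<open>ln k\<close> for every \<open>k\<close> from 2 on.\<close>
  let ?f = "\<lambda>x. iso_const G 1 - iso_const G 1 / ln 2 * x"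
  have "convex_on {0..ln (real (card (verts G)))} (\<lambda>x. d - c * x)" for c d :: real
    by (rule convex_onI) (auto simp: algebra_simps)
  then have "convex_on {0..ln (real (card (verts G)))} ?f" .
  moreover have "?f (ln (real k)) \<le> iso_const G k" if k': "k \<in> {1..card (verts G)}" for k
  proof (cases "k = 1")
    case False
    then have "ln 2 \<le> ln (real k)" using k' by simp
    then have "iso_const G 1 * ln 2 \<le> iso_const G 1 * ln (real k)"
      using nonneg[of 1] k by (intro mult_left_mono) auto
    then have "?f (ln (real k)) \<le> 0" by (simp add: field_simps)
    then show ?thesis using nonneg[OF k'] by linarith
  qed simp
  ultimately show "psi_minorant G ?f" by (simp add: psi_minorant_def)
qed

lemma convex_on_psi:
  assumes "finite_graph G" "verts G \<noteq> {}"
  shows "convex_on {0..ln (real (card (verts G)))} (psi G)"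
  using psi_minorant_psi[OF assms] by (simp add: psi_minorant_def)

lemma right_derivative_psi_le_slope:
  assumes G: "finite_graph G" "verts G \<noteq> {}"
    and x: "0 \<le> x" and y: "y \<in> {x<..ln (real (card (verts G)))}"
    and x0: "x = 0 \<Longrightarrow> psi G 0 = iso_const G 1"
  shows "right_derivative (psi G) x \<le> (psi G y - psi G x) / (y - x)"
proof (rule convex_right_derivative_le_slope[OF _ y])
  show "convex_on {x..ln (real (card (verts G)))} (psi G)"
    by (rule convex_on_subset[OF convex_on_psi[OF G]]) (use x in auto)
next
  fix z assume z: "z \<in> {x<..ln (real (card (verts G)))}"
  \<comment> \<open>The lower bound that makes the derivative exist: for \<open>x > 0\<close> the
    slope of the chord from 0 to \<open>x\<close>, and at 0 the slope of the line in
    \<open>affine_le_psi\<close>, which starts at \<open>psi G 0\<close> by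
    \<open>x0\<close>.\<close>
  show "(if x = 0 then - (iso_const G 1 / ln 2) else (psi G 0 - psi G x) / (0 - x))
    \<le> (psi G z - psi G x) / (z - x)"
  proof (cases "x = 0")
    case True
    have "iso_const G 1 - iso_const G 1 / ln 2 * z \<le> psi G z"
      using G x z by (intro affine_le_psi) (auto simp: finite_graph_def Suc_le_eq card_gt_0_iff)
    then show ?thesis using True x0 z by (simp add: pos_le_divide_eq)
  next
    case False
    have "(psi G 0 - psi G x) / (0 - x) \<le> (psi G 0 - psi G z) / (0 - z)"
      and "(psi G 0 - psi G z) / (0 - z) \<le> (psi G x - psi G z) / (x - z)"
      using False x z by (intro convex_on_slope_le[OF convex_on_psi[OF G]]; auto)+
    moreover have "(psi G x - psi G z) / (x - z) = (psi G z - psi G x) / (z - x)"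
      by (metis minus_diff_eq minus_divide_divide)
    ultimately show ?thesis using False by simp
  qed
qed

lemma slope_le_left_derivative_psi:
  assumes G: "finite_graph G" "verts G \<noteq> {}"
    and x: "x \<le> ln (real (card (verts G)))" and y: "y \<in> {0..<x}"
    and x1: "x = ln (real (card (verts G))) \<Longrightarrow> psi G x = 0"
  shows "(psi G x - psi G y) / (x - y) \<le> left_derivative (psi G) x"
proof (rule convex_slope_le_left_derivative[OF _ y])
  show "convex_on {0..x} (psi G)"
    by (rule convex_on_subset[OF convex_on_psi[OF G]]) (use x in auto)
next
  let ?m = "ln (real (card (verts G)))"
  fix z assume z: "z \<in> {0..<x}"
  \<comment> \<open>The upper bound on left quotients: away from the right end the slope of the
    chord from \<open>x\<close> to that end, and at the right end 0, since \<open>psi\<close>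
    vanishes there and is nonnegative elsewhere.\<close>
  show "(psi G x - psi G z) / (x - z) \<le>
    (if x = ?m then 0 else (psi G x - psi G ?m) / (x - ?m))"
  proof (cases "x = ?m")
    case True
    then show ?thesis using psi_nonneg[OF G, of z] x1 z by (simp add: divide_le_0_iff)
  next
    case False
    have "(psi G z - psi G x) / (z - x) \<le> (psi G z - psi G ?m) / (z - ?m)"
      and "(psi G z - psi G ?m) / (z - ?m) \<le> (psi G x - psi G ?m) / (x - ?m)"
      using False x z by (intro convex_on_slope_le[OF convex_on_psi[OF G]]; auto)+
    moreover have "(psi G x - psi G z) / (x - z) = (psi G z - psi G x) / (z - x)"
      by (metis minus_diff_eq minus_divide_divide)
    ultimately show ?thesis using False by simp
  qed
qed

text \<open>A real \<open>c\<close> between the one-sided derivatives is a subgradient at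
  \<open>x\<close>. For \<open>y < x\<close> the point \<open>x\<close> is not 0, and for
  \<open>y > x\<close> it is not the right end, so the infinite conventions never enter on the side
  that is used.\<close>

lemma psi_supporting_line:
  assumes G: "finite_graph G" "verts G \<noteq> {}"
    and x: "x \<in> {0..ln (real (card (verts G)))}" and y: "y \<in> {0..ln (real (card (verts G)))}"
    and x0: "x = 0 \<Longrightarrow> psi G 0 = iso_const G 1"
    and x1: "x = ln (real (card (verts G))) \<Longrightarrow> psi G x = 0"
    and l: "left_slope G x \<le> ereal c" and r: "ereal c \<le> right_slope G x"
  shows "psi G x + c * (y - x) \<le> psi G y"
proof (cases y x rule: linorder_cases)
  case less
  then have "left_derivative (psi G) x \<le> c" using l x y by (auto simp: left_slope_def)
  with slope_le_left_derivative_psi[OF G, of x y] less x y x1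
  have "(psi G x - psi G y) / (x - y) \<le> c" by fastforce
  then show ?thesis using less by (simp add: pos_divide_le_eq algebra_simps)
next
  case greater
  then have "c \<le> right_derivative (psi G) x" using r x y by (auto simp: right_slope_def)
  with right_derivative_psi_le_slope[OF G, of x y] greater x y x0
  have "c \<le> (psi G y - psi G x) / (y - x)" by fastforce
  then show ?thesis using greater by (simp add: pos_le_divide_eq algebra_simps)
qed simp

lemma edge_boundary_verts: "edge_boundary G (verts G) = 0"
  by (simp add: edge_boundary_def)

text \<open>The endpoint conventions can make the largest left slope or the smallest right slope
  infinite, yet a line needs a real slope; one exists unless both bounds are the same
  infinity.\<close>

lemma ereal_between_real:
  assumes "l \<le> r" "l \<noteq> \<infinity>" "r \<noteq> - \<infinity>"
  obtains c where "l \<le> ereal c" "ereal c \<le> r"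
proof (cases l)
  case MInf
  show thesis
    by (cases r) (use MInf assms that in auto)
qed (use assms that in auto)

section \<open>Powers of a graph with two kinds of factor sets, for (a)\<close>

text \<open>Affine functions preserve weighted means, so \<open>n\<close> times \<open>psi\<close>
  at the mean log size is the sum of the values of \<open>psi\<close> over the coordinates, and
  these values are the boundary ratios.\<close>

lemma edge_boundary_two_block_power:
  fixes G :: "'a graph"
  assumes n: "n \<ge> 1" and G: "finite_graph G" and k: "0 < card A1" "card A1 < card A2"
    and tight: "psi G (ln (real (card A1))) = iso_const G (card A1)"
      "psi G (ln (real (card A2))) = iso_const G (card A2)"
    and lin: "\<And>x. x \<in> {ln (real (card A1))..ln (real (card A2))} \<Longrightarrow> psi G x = a * x + b"
    and sub: "A1 \<subseteq> verts G" "A2 \<subseteq> verts G"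
    and opt: "real (edge_boundary G A1) = iso_const G (card A1) * real (card A1)"
      "real (edge_boundary G A2) = iso_const G (card A2) * real (card A2)"
    and n12: "n1 + n2 = n"
    and A: "A = (\<Pi>\<^sub>E i\<in>{1..n}. if i \<le> n1 then A1 else A2)"
  shows "real (edge_boundary (graph_power G n) A) =
    real (card A) * real n * psi G (ln (real (card A)) / real n)"
proof -
  let ?x1 = "ln (real (card A1))" and ?x2 = "ln (real (card A2))"
  have fin: "finite A1" "finite A2" and ne: "A1 \<noteq> {}" "A2 \<noteq> {}"
    using k by (auto intro: card_ge_0_finite)
  have split: "(\<Sum>i=1..n. if i \<le> n1 then u else v) = real n1 * u + real n2 * v" for u v :: real
  proof -
    have "{1..n} \<inter> {i. i \<le> n1} = {1..n1}" "{1..n} \<inter> - {i. i \<le> n1} = {n1+1..n}"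
      using n12 by auto
    then show ?thesis using n12 by (simp add: sum.If_cases)
  qed
  have "ln (real (card A)) = (\<Sum>i=1..n. ln (real (card (if i \<le> n1 then A1 else A2))))"
    unfolding A by (rule ln_card_PiE) (use fin ne in auto)
  also have "\<dots> = (\<Sum>i=1..n. if i \<le> n1 then ?x1 else ?x2)"
    by (intro sum.cong) auto
  finally have lnA: "ln (real (card A)) = real n1 * ?x1 + real n2 * ?x2"
    by (simp only: split)
  have x12: "?x1 \<le> ?x2" using k by simp
  \<comment> \<open>These bounds place the weighted mean of the two log sizes inside the interval on
    which \<open>psi\<close> is affine.\<close>
  have "real n1 * ?x1 \<le> real n1 * ?x2" "real n2 * ?x1 \<le> real n2 * ?x2"
    using x12 by (auto intro: mult_left_mono)
  then have "ln (real (card A)) / real n \<in> {?x1..?x2}"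
    unfolding lnA using n n12 by (auto simp: field_simps)
  then have "real n * psi G (ln (real (card A)) / real n) = a * ln (real (card A)) + real n * b"
    using n by (simp add: lin field_simps)
  also have "\<dots> = real n1 * (a * ?x1 + b) + real n2 * (a * ?x2 + b)"
    unfolding lnA n12[symmetric] by (simp add: algebra_simps)
  also have "\<dots> = real n1 * psi G ?x1 + real n2 * psi G ?x2"
    using x12 by (simp add: lin)
  also have "\<dots> = (\<Sum>i=1..n. real (edge_boundary G (if i \<le> n1 then A1 else A2)) /
      real (card (if i \<le> n1 then A1 else A2)))"
    unfolding split[symmetric] using opt tight k by (intro sum.cong) auto
  finally show ?thesis
    unfolding A graph_power_def
    by (subst edge_boundary_box_prod) (use G sub ne in \<open>auto simp: mult.assoc\<close>)
qed

section \<open>Minimality over log sizes with prescribed sum, for (b)\<close>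

text \<open>The minimum is expressed through an attained value \<open>t\<close>; the witness is the
  sum at \<open>h i = ln (card (A i))\<close>, a feasible choice because log sizes add up in a
  product.\<close>

lemma edge_boundary_box_prod_eq_minimum:
  fixes G :: "nat \<Rightarrow> 'b graph"
  assumes n: "n \<ge> 1"
    and G: "\<And>i. i \<in> {1..n} \<Longrightarrow> finite_graph (G i)"
    and ne: "\<And>i. i \<in> {1..n} \<Longrightarrow> A i \<noteq> {}"
    and sub: "\<And>i. i \<in> {1..n} \<Longrightarrow> A i \<subseteq> verts (G i)"
    and opt: "\<And>i. i \<in> {1..n} \<Longrightarrow>
      real (edge_boundary (G i) (A i)) / real (card (A i)) = iso_const (G i) (card (A i))"
    and tight: "\<And>i. i \<in> {1..n} \<Longrightarrow>
      iso_const (G i) (card (A i)) = psi (G i) (ln (real (card (A i))))"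
    and slopes: "Max ((\<lambda>i. left_slope (G i) (ln (real (card (A i))))) ` {1..n})
      \<le> Min ((\<lambda>i. right_slope (G i) (ln (real (card (A i))))) ` {1..n})"
    and P: "P = (\<Pi>\<^sub>E i\<in>{1..n}. A i)"
  shows "\<exists>t. is_minimum
      {(\<Sum>i=1..n. psi (G i) (h i)) | h :: nat \<Rightarrow> real.
         (\<forall>i\<in>{1..n}. 0 \<le> h i \<and> h i \<le> ln (real (card (verts (G i))))) \<and>
         (\<Sum>i=1..n. h i) = ln (real (card P))} t \<and>
    real (edge_boundary (box_prod n G) P) = real (card P) * t"
proof -
  define x where "x = (\<lambda>i. ln (real (card (A i))))"
  let ?L = "(\<lambda>i. left_slope (G i) (x i)) ` {1..n}" and ?R = "(\<lambda>i. right_slope (G i) (x i)) ` {1..n}"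
  have nonempty: "{1..n} \<noteq> {}" using n by simp
  have "Max ?L \<in> ?L" "Min ?R \<in> ?R"
    using nonempty by (intro Max_in Min_in; simp)+
  \<comment> \<open>Both extrema are attained, no left slope is plus infinity and no right slope is
    minus infinity, so one real slope \<open>c\<close> fits all factors at once.\<close>
  then have "Max ?L \<noteq> \<infinity>" "Min ?R \<noteq> - \<infinity>"
    by (auto simp: left_slope_def right_slope_def split: if_splits)
  with slopes obtain c where c: "Max ?L \<le> ereal c" "ereal c \<le> Min ?R"
    unfolding x_def by (rule ereal_between_real)
  have fin: "finite (verts (G i))" "finite (A i)" if "i \<in> {1..n}" for i
    using G[OF that] sub[OF that] by (auto simp: finite_graph_def intro: finite_subset)
  have pos: "0 < card (A i)" "card (A i) \<le> card (verts (G i))" if "i \<in> {1..n}" for i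
    using fin[OF that] ne[OF that] sub[OF that] by (auto simp: card_gt_0_iff intro: card_mono)
  have x_range: "x i \<in> {0..ln (real (card (verts (G i))))}" if "i \<in> {1..n}" for i
    using pos[OF that] by (simp add: x_def)
  have support: "psi (G i) (x i) + c * (y - x i) \<le> psi (G i) y"
    if i: "i \<in> {1..n}" and y: "y \<in> {0..ln (real (card (verts (G i))))}" for i y
  proof (rule psi_supporting_line[OF G[OF i] _ x_range[OF i] y])
    show "verts (G i) \<noteq> {}" using ne[OF i] sub[OF i] by auto
    \<comment> \<open>Log size 0 means that \<open>A i\<close> is a single vertex, so tightness
      speaks of \<open>k = 1\<close>.\<close>
    show "psi (G i) 0 = iso_const (G i) 1" if "x i = 0"
      using that tight[OF i] pos[OF i] by (simp add: x_def)
    show "psi (G i) (x i) = 0" if "x i = ln (real (card (verts (G i))))"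
    proof -
      \<comment> \<open>Maximal log size means that \<open>A i\<close> is the whole vertex set,
        whose edge boundary is empty.\<close>
      have "card (A i) = card (verts (G i))" using that pos[OF i] by (simp add: x_def)
      then have "A i = verts (G i)" using card_subset_eq fin[OF i] sub[OF i] by blast
      then show ?thesis using opt[OF i] tight[OF i] by (simp add: edge_boundary_verts x_def)
    qed
    show "left_slope (G i) (x i) \<le> ereal c"
      using c(1) i by (auto simp: Max_le_iff)
    show "ereal c \<le> right_slope (G i) (x i)"
      using c(2) i by (auto simp: Min_ge_iff)
  qed
  have sum_x: "(\<Sum>i=1..n. x i) = ln (real (card P))"
    unfolding P x_def by (rule ln_card_PiE[symmetric]) (use fin ne in auto)
  have "(\<Sum>i=1..n. psi (G i) (x i)) \<le> (\<Sum>i=1..n. psi (G i) (h i))"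
    if h: "\<forall>i\<in>{1..n}. 0 \<le> h i \<and> h i \<le> ln (real (card (verts (G i))))"
      and sum_h: "(\<Sum>i=1..n. h i) = ln (real (card P))" for h
  proof -
    \<comment> \<open>\<open>h\<close> and \<open>x\<close> have the same sum, so the linear terms
      with the common slope \<open>c\<close> cancel.\<close>
    have "(\<Sum>i=1..n. psi (G i) (x i)) = (\<Sum>i=1..n. psi (G i) (x i) + c * (h i - x i))"
      using sum_h sum_x by (simp add: sum.distrib sum_subtractf flip: sum_distrib_left)
    also have "\<dots> \<le> (\<Sum>i=1..n. psi (G i) (h i))"
      using h by (intro sum_mono support) auto
    finally show ?thesis .
  qed
  moreover have "real (edge_boundary (box_prod n G) P) = real (card P) * (\<Sum>i=1..n. psi (G i) (x i))"
    unfolding P by (subst edge_boundary_box_prod) (use G sub ne opt tight in \<open>auto simp: x_def\<close>)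
  ultimately show ?thesis
    using x_range sum_x unfolding is_minimum_def
    by (intro exI[of _ "\<Sum>i=1..n. psi (G i) (x i)"]) auto
qed

section \<open>Statements (a) and (b) together, for a fixed number of factors\<close>

theorem mainTheorem2:
  fixes n :: nat
  assumes "n \<ge> 1"
  shows
    "(\<forall>(G :: 'a graph) (m :: nat) (k1 :: nat) (k2 :: nat) A1 A2.
        finite_graph G \<and> card (verts G) = m \<and> k1 \<in> {1..m} \<and> k2 \<in> {1..m} \<and> k1 < k2 \<and>
        psi G (ln (real k1)) = iso_const G k1 \<and>
        psi G (ln (real k2)) = iso_const G k2 \<and>
        (\<exists>a b. \<forall>x\<in>{ln (real k1)..ln (real k2)}. psi G x = a * x + b) \<and>
        A1 \<subseteq> verts G \<and> A2 \<subseteq> verts G \<and> card A1 = k1 \<and> card A2 = k2 \<and>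
        real (edge_boundary G A1) = iso_const G k1 * real k1 \<and>
        real (edge_boundary G A2) = iso_const G k2 * real k2
        \<longrightarrow> (\<forall>n1 n2 :: nat. n1 + n2 = n \<longrightarrow>
              (let A = (\<Pi>\<^sub>E i\<in>{1..n}. if i \<le> n1 then A1 else A2) in
                real (edge_boundary (graph_power G n) A) =
                  real (card A) * real n * psi G (ln (real (card A)) / real n))))
     \<and>
     (\<forall>(G :: nat \<Rightarrow> 'b graph) (A :: nat \<Rightarrow> 'b set).
        (\<forall>i\<in>{1..n}. finite_graph (G i) \<and> A i \<noteq> {} \<and> A i \<subseteq> verts (G i) \<and>
           real (edge_boundary (G i) (A i)) / real (card (A i)) = iso_const (G i) (card (A i)) \<and>
           iso_const (G i) (card (A i)) = psi (G i) (ln (real (card (A i))))) \<and>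
        Max ((\<lambda>i. left_slope (G i) (ln (real (card (A i))))) ` {1..n})
          \<le> Min ((\<lambda>i. right_slope (G i) (ln (real (card (A i))))) ` {1..n})
        \<longrightarrow> (let P = (\<Pi>\<^sub>E i\<in>{1..n}. A i) in
              \<exists>t. is_minimum
                    {(\<Sum>i=1..n. psi (G i) (h i)) | h :: nat \<Rightarrow> real.
                       (\<forall>i\<in>{1..n}. 0 \<le> h i \<and> h i \<le> ln (real (card (verts (G i))))) \<and>
                       (\<Sum>i=1..n. h i) = ln (real (card P))} t \<and>
                  real (edge_boundary (box_prod n G) P) = real (card P) * t))"
proof (intro conjI allI impI, goal_cases)
  case (1 G m k1 k2 A1 A2 n1 n2)
  then obtain a b where "\<forall>x\<in>{ln (real k1)..ln (real k2)}. psi G x = a * x + b" by blast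
  with 1 show ?case
    unfolding Let_def by (intro edge_boundary_two_block_power[OF assms, where a = a and b = b]) auto
next
  case (2 G A)
  then show ?case
    unfolding Let_def by (intro edge_boundary_box_prod_eq_minimum[OF assms]) auto
qed

end
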